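(* Let $K$ be a simplicial complex over a type $E$, let $s \in K$ be a face and let $x \in E$ with $x \notin V(K)$. If $t \in \mathrm{Lk}(K,s) \star \partial s$, then \[ \mathrm{Lk}(\sigma_s K, t) = \sigma_{s \setminus t}\big(\mathrm{Lk}(K,t)\big), \] where both stellar subdivisions are taken with barycenter $x$.
   Context: A simplicial complex over a type (set) $E$ is a set $K$ of nonempty finite subsets of $E$ (its faces) such that every nonempty subset of a face is a face. It may be empty or infinite, and not every element of $E$ need be a vertex. $V(K) = \{x \in E \mid \{x\} \in K\}$. For a finite set $s \subseteq E$: the link is $\mathrm{Lk}(K,s) = \{t \in K \mid s \cup t \in K,\ s \cap t = \emptyset\}$; the boundary is $\partial s = \{t \subseteq s \mid t \ne \emptyset,\ t \neq s\}$; the star complement, written $K \setminus \mathrm{St}(K,s)$, is $\{t \in K \mid s \not\subseteq t\}$. For complexes $A, B$ over $E$ with disjoint vertex sets, $A \star B$ (regarded as a complex over $E$) has as faces all nonempty sets $a \cup b$ with $a \in A \cup \{\emptyset\}$, $b \in B \cup \{\emptyset\}$. For $s \in K$ and $x \in E \setminus V(K)$, the stellar subdivision of $K$ at $s$ with barycenter $x$ is $\sigma_s K = (K \setminus \mathrm{St}(K,s)) \cup (\mathrm{Lk}(K,s) \star \partial s \star \{x\})$, where $\{x\}$ denotes the complex with single face $\{x\}$. That is, the faces of $\sigma_s K$ are the faces of $K$ not containing $s$ together with all nonempty sets $a \cup b \cup c$ with $a \in \mathrm{Lk}(K,s) \cup \{\emptyset\}$, $b \in \partial s \cup \{\emptyset\}$,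 $c \in \{\emptyset, \{x\}\}$. (Under the hypothesis on $t$, $s \setminus t$ is a face of $\mathrm{Lk}(K,t)$, so the right-hand side of the claim is defined.) *)

theory Defs
  imports Main
begin

text \<open>
  A complex over the ground type is its set of faces, so equality of complexes is equality of
  face sets. The empty set is never a face; the empty complex and infinite complexes are allowed.
\<close>

definition simplicial_complex :: "'a set set \<Rightarrow> bool" where
  "simplicial_complex K \<longleftrightarrow>
     (\<forall>s\<in>K. finite s \<and> s \<noteq> {}) \<and>
     (\<forall>s\<in>K. \<forall>t. t \<subseteq> s \<and> t \<noteq> {} \<longrightarrow> t \<in> K)"

definition vertices :: "'a set set \<Rightarrow> 'a set" where
  "vertices K = {x. {x} \<in> K}"

definition link :: "'a set set \<Rightarrow> 'a set \<Rightarrow> 'a set set" where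
  "link K s = {t \<in> K. s \<union> t \<in> K \<and> s \<inter> t = {}}"

definition boundary :: "'a set \<Rightarrow> 'a set set" where
  "boundary s = {t. t \<subseteq> s \<and> t \<noteq> {} \<and> t \<noteq> s}"

definition star_complement :: "'a set set \<Rightarrow> 'a set \<Rightarrow> 'a set set" where
  "star_complement K s = {t \<in> K. \<not> s \<subseteq> t}"

text \<open>
  The join within the ground type is meaningful for complexes with disjoint vertex sets;
  it is a total function here, and the disjointness is established below where it is used.
\<close>

definition join :: "'a set set \<Rightarrow> 'a set set \<Rightarrow> 'a set set"  (infixl \<open>\<star>\<close> 70) where
  "A \<star> B = {a \<union> b | a b. a \<in> insert {} A \<and> b \<in> insert {} B \<and> a \<union> b \<noteq> {}}"

text \<open>
  The stellar subdivision of \<open>K\<close> at \<open>s\<close> with barycenter \<open>x\<close>, intended for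
  \<open>s \<in> K\<close> and \<open>x \<notin> vertices K\<close>; \<open>{{x}}\<close> is the complex with the single face \<open>{x}\<close>.
\<close>

definition stellar_subdivision :: "'a \<Rightarrow> 'a set \<Rightarrow> 'a set set \<Rightarrow> 'a set set" where
  "stellar_subdivision x s K = star_complement K s \<union> (link K s \<star> boundary s \<star> {{x}})"

lemma simplicial_complex_subset:
  "simplicial_complex K \<Longrightarrow> s \<in> K \<Longrightarrow> t \<subseteq> s \<Longrightarrow> t \<noteq> {} \<Longrightarrow> t \<in> K"
  unfolding simplicial_complex_def by blast

lemma simplicial_complex_face:
  "simplicial_complex K \<Longrightarrow> s \<in> K \<Longrightarrow> finite s \<and> s \<noteq> {}"
  unfolding simplicial_complex_def by blast

lemma simplicial_complexI:
  assumes "\<And>s. s \<in> K \<Longrightarrow> finite s" "\<And>s. s \<in> K \<Longrightarrow> s \<noteq> {}"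
    and "\<And>s t. s \<in> K \<Longrightarrow> t \<subseteq> s \<Longrightarrow> t \<noteq> {} \<Longrightarrow> t \<in> K"
  shows "simplicial_complex K"
  using assms unfolding simplicial_complex_def by blast

lemma simplicial_complex_link:
  assumes K: "simplicial_complex K"
  shows "simplicial_complex (link K s)"
proof (rule simplicial_complexI)
  fix t assume t: "t \<in> link K s"
  then have tK: "t \<in> K" "s \<union> t \<in> K" "s \<inter> t = {}" by (simp_all add: link_def)
  show "finite t" "t \<noteq> {}"
    using simplicial_complex_face[OF K tK(1)] by simp_all
  fix u assume u: "u \<subseteq> t" "u \<noteq> {}"
  have "u \<in> K" by (rule simplicial_complex_subset[OF K tK(1) u])
  moreover have "s \<union> u \<in> K"
    by (rule simplicial_complex_subset[OF K tK(2)]) (use u in auto)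
  moreover have "s \<inter> u = {}" using tK(3) u by auto
  ultimately show "u \<in> link K s" by (simp add: link_def)
qed

lemma simplicial_complex_boundary: "finite s \<Longrightarrow> simplicial_complex (boundary s)"
  by (rule simplicial_complexI) (auto simp: boundary_def intro: finite_subset)

lemma simplicial_complex_star_complement:
  assumes K: "simplicial_complex K"
  shows "simplicial_complex (star_complement K s)"
proof (rule simplicial_complexI)
  fix t assume "t \<in> star_complement K s"
  then have t: "t \<in> K" "\<not> s \<subseteq> t" by (simp_all add: star_complement_def)
  show "finite t" "t \<noteq> {}"
    using simplicial_complex_face[OF K t(1)] by simp_all
  fix u assume u: "u \<subseteq> t" "u \<noteq> {}"
  have "\<not> s \<subseteq> u" using t(2) u(1) by blast
  then show "u \<in> star_complement K s"
    using simplicial_complex_subset[OF K t(1) u] by (simp add: star_complement_def)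
qed

lemma simplicial_complex_join:
  assumes A: "simplicial_complex A" and B: "simplicial_complex B"
  shows "simplicial_complex (A \<star> B)"
proof (rule simplicial_complexI)
  fix t assume "t \<in> A \<star> B"
  then obtain a b where ab: "t = a \<union> b" "a \<in> insert {} A" "b \<in> insert {} B" "t \<noteq> {}"
    unfolding join_def by auto
  have "finite a" "finite b"
    using ab(2,3) simplicial_complex_face[OF A] simplicial_complex_face[OF B] by auto
  then show "finite t" "t \<noteq> {}" using ab by simp_all
  fix u assume u: "u \<subseteq> t" "u \<noteq> {}"
  have eq: "u = (a \<inter> u) \<union> (b \<inter> u)" using u ab(1) by auto
  have "a \<inter> u \<in> insert {} A"
    using ab(2) simplicial_complex_subset[OF A, of a "a \<inter> u"] by blast
  moreover have "b \<inter> u \<in> insert {} B"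
    using ab(3) simplicial_complex_subset[OF B, of b "b \<inter> u"] by blast
  ultimately have "u = (a \<inter> u) \<union> (b \<inter> u) \<and> a \<inter> u \<in> insert {} A \<and> b \<inter> u \<in> insert {} B
      \<and> (a \<inter> u) \<union> (b \<inter> u) \<noteq> {}"
    using eq[symmetric] u(2) by simp
  then show "u \<in> A \<star> B" unfolding join_def by (intro CollectI exI)
qed

lemma simplicial_complex_Un:
  assumes A: "simplicial_complex A" and B: "simplicial_complex B"
  shows "simplicial_complex (A \<union> B)"
proof (rule simplicial_complexI)
  fix t assume t: "t \<in> A \<union> B"
  show "finite t" "t \<noteq> {}"
    using t simplicial_complex_face[OF A, of t] simplicial_complex_face[OF B, of t] by auto
  fix u assume u: "u \<subseteq> t" "u \<noteq> {}"
  show "u \<in> A \<union> B"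
    using t simplicial_complex_subset[OF A _ u] simplicial_complex_subset[OF B _ u] by blast
qed

lemma simplicial_complex_stellar_subdivision:
  assumes K: "simplicial_complex K" and s: "s \<in> K"
  shows "simplicial_complex (stellar_subdivision x s K)"
proof -
  have "simplicial_complex {{x}}"
    by (rule simplicial_complexI) (auto simp: subset_singleton_iff)
  moreover have "simplicial_complex (boundary s)"
    by (rule simplicial_complex_boundary) (simp add: simplicial_complex_face[OF K s])
  ultimately show ?thesis
    unfolding stellar_subdivision_def
    by (intro simplicial_complex_Un simplicial_complex_join simplicial_complex_link[OF K]
        simplicial_complex_star_complement[OF K])
qed

lemma join_disjoint_link_boundary:
  "vertices (link K s) \<inter> vertices (boundary s) = {}"
  by (auto simp: vertices_def link_def boundary_def)

lemma join_disjoint_barycenter: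
  assumes K: "simplicial_complex K" and s: "s \<in> K" and x: "x \<notin> vertices K"
  shows "vertices (link K s \<star> boundary s) \<inter> vertices {{x}} = {}"
proof -
  have xK: "x \<notin> u" if "u \<in> K" for u
    using simplicial_complex_subset[OF K that, of "{x}"] x by (auto simp: vertices_def)
  have l: "x \<notin> u" if "u \<in> insert {} (link K s)" for u
    using that xK[of u] by (auto simp: link_def)
  have b: "x \<notin> u" if "u \<in> insert {} (boundary s)" for u
    using that xK[OF s] by (auto simp: boundary_def)
  have "{x} \<notin> link K s \<star> boundary s"
  proof
    assume "{x} \<in> link K s \<star> boundary s"
    then obtain u v where uv: "{x} = u \<union> v" "u \<in> insert {} (link K s)" "v \<in> insert {} (boundary s)"
      unfolding join_def by blast
    have "x \<in> u \<union> v" unfolding uv(1)[symmetric] by simp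
    with l[OF uv(2)] b[OF uv(3)] show False by simp
  qed
  then show ?thesis by (auto simp: vertices_def)
qed

text \<open>
  The subdivision of \<open>link K t\<close> at \<open>s - t\<close> with barycenter \<open>x\<close> is defined whenever
  \<open>t\<close> is a face of \<open>link K s \<star> boundary s\<close>.
\<close>

lemma diff_mem_link:
  assumes K: "simplicial_complex K" and s: "s \<in> K" and t: "t \<in> link K s \<star> boundary s"
  shows "s - t \<in> link K t"
proof -
  obtain a b where ab: "t = a \<union> b" "a \<in> insert {} (link K s)" "b \<in> insert {} (boundary s)"
    using t unfolding join_def by auto
  have sa: "s \<union> a \<in> K" "s \<inter> a = {}" using ab(2) s by (auto simp: link_def)
  have b: "b \<subseteq> s" "b \<noteq> s"
    using ab(3) simplicial_complex_face[OF K s] by (auto simp: boundary_def)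
  have "s - t \<noteq> {}" using b sa(2) ab(1) by auto
  then have "s - t \<in> K" by (intro simplicial_complex_subset[OF K s]) auto
  moreover have "t \<union> (s - t) = s \<union> a" using ab(1) b(1) by auto
  ultimately show ?thesis using sa(1) by (auto simp: link_def)
qed

lemma not_vertex_link: "x \<notin> vertices K \<Longrightarrow> x \<notin> vertices (link K t)"
  by (simp add: vertices_def link_def)

end

theory Submission
  imports Defs
begin

text \<open>
  Since \<open>s\<close> and \<open>x\<close> determine how a face of the join decomposes, a nonempty set \<open>u\<close> is a face
  of the subdivision iff \<open>\<not> s \<subseteq> u\<close> and either \<open>u - {x} \<union> s \<in> K\<close>, or \<open>x \<notin> u\<close> and \<open>u \<in> K\<close>.
  In these terms both sides of the claim say, for a nonempty \<open>v\<close> disjoint from \<open>t\<close>, that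
  \<open>\<not> s \<subseteq> t \<union> v\<close> and either \<open>t \<union> (v - {x}) \<union> s \<in> K\<close>, or \<open>x \<notin> v\<close> and \<open>t \<union> v \<in> K\<close>.
\<close>

lemma not_mem_face_if_not_vertex:
  assumes "simplicial_complex K" "x \<notin> vertices K" "u \<in> K"
  shows "x \<notin> u"
  using simplicial_complex_subset[OF assms(1,3), of "{x}"] assms(2)
  by (auto simp: vertices_def)

text \<open>Closure under nonempty subsets gives \<open>u \<in> K\<close> from
  \<open>s \<union> u \<in> K\<close>, so only nonemptiness of \<open>u\<close> has to be
  kept.\<close>

lemma mem_link_iff:
  assumes K: "simplicial_complex K"
  shows "u \<in> link K s \<longleftrightarrow> u \<noteq> {} \<and> s \<union> u \<in> K \<and> s \<inter> u = {}"
  using simplicial_complex_subset[OF K, of "s \<union> u" u] simplicial_complex_face[OF K, of u]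
  by (auto simp: link_def)

lemma joinI:
  assumes "u = a \<union> b" "a \<in> insert {} A" "b \<in> insert {} B" "u \<noteq> {}"
  shows "u \<in> A \<star> B"
  using assms unfolding join_def by (intro CollectI exI[of _ a] exI[of _ b]) simp

lemma joinE:
  assumes "u \<in> A \<star> B"
  obtains a b where "u = a \<union> b" "u \<noteq> {}" "a \<in> insert {} A" "b \<in> insert {} B"
  using assms unfolding join_def by blast

text \<open>The only possible decomposition of \<open>u\<close> is \<open>u - s\<close> in the link
  and \<open>u \<inter> s\<close> in the boundary. The first part is admissible iff
  \<open>u \<union> s \<in> K\<close>, the second iff it is not all of \<open>s\<close>.\<close>

lemma mem_join_link_boundary_iff:
  assumes K: "simplicial_complex K" and s: "s \<in> K"
  shows "u \<in> link K s \<star> boundary s \<longleftrightarrow> u \<noteq> {} \<and> \<not> s \<subseteq> u \<and> u \<union> s \<in> K"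
proof
  assume "u \<in> link K s \<star> boundary s"
  then obtain a b where u: "u = a \<union> b" "u \<noteq> {}"
    and a: "a \<in> insert {} (link K s)" and b: "b \<in> insert {} (boundary s)"
    by (rule joinE)
  have sa: "s \<union> a \<in> K" "s \<inter> a = {}"
    using a s by (auto simp: link_def)
  have sb: "b \<subseteq> s" "b \<noteq> s"
    using b simplicial_complex_face[OF K s] by (auto simp: boundary_def)
  have "u \<union> s = s \<union> a" "\<not> s \<subseteq> u"
    using u sa(2) sb by auto
  then show "u \<noteq> {} \<and> \<not> s \<subseteq> u \<and> u \<union> s \<in> K"
    using u(2) sa(1) by simp
next
  assume u: "u \<noteq> {} \<and> \<not> s \<subseteq> u \<and> u \<union> s \<in> K"
  have "s \<union> (u - s) = u \<union> s"
    by auto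
  then have "u - s \<in> insert {} (link K s)"
    using u by (auto simp: mem_link_iff[OF K])
  moreover have "u \<inter> s \<in> insert {} (boundary s)"
    using u by (auto simp: boundary_def)
  moreover have "u = (u - s) \<union> (u \<inter> s)"
    by auto
  ultimately show "u \<in> link K s \<star> boundary s"
    using u by (intro joinI[of u "u - s" "u \<inter> s"]) simp_all
qed

text \<open>As \<open>x\<close> lies in no face of \<open>A\<close>, deleting \<open>x\<close> from
  \<open>u\<close> recovers its \<open>A\<close>-part.\<close>

lemma mem_join_singleton_iff:
  assumes "x \<notin> \<Union>A"
  shows "u \<in> A \<star> {{x}} \<longleftrightarrow> u \<noteq> {} \<and> u - {x} \<in> insert {} A"
proof
  assume "u \<in> A \<star> {{x}}"
  then obtain a c where u: "u = a \<union> c" "u \<noteq> {}" and a: "a \<in> insert {} A" and c: "c \<in> {{}, {x}}"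
    by (rule joinE)
  have "u - {x} = a"
    using u a c assms by auto
  then show "u \<noteq> {} \<and> u - {x} \<in> insert {} A"
    using u a by simp
next
  assume u: "u \<noteq> {} \<and> u - {x} \<in> insert {} A"
  have "u = (u - {x}) \<union> (u \<inter> {x})" "u \<inter> {x} \<in> insert {} {{x}}"
    by auto
  then show "u \<in> A \<star> {{x}}"
    using u by (intro joinI[of u "u - {x}" "u \<inter> {x}"]) simp_all
qed

lemma mem_stellar_subdivision_iff:
  assumes K: "simplicial_complex K" and s: "s \<in> K" and x: "x \<notin> vertices K"
  shows "u \<in> stellar_subdivision x s K \<longleftrightarrow>
    u \<noteq> {} \<and> \<not> s \<subseteq> u \<and> (u - {x} \<union> s \<in> K \<or> x \<notin> u \<and> u \<in> K)"
proof -
  have xK: "x \<notin> v" if "v \<in> K" for v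
    using not_mem_face_if_not_vertex[OF K x that] .
  have xJ: "x \<notin> \<Union>(link K s \<star> boundary s)"
    using xK mem_join_link_boundary_iff[OF K s] by blast
  have "s \<subseteq> u - {x} \<longleftrightarrow> s \<subseteq> u"
    using xK[OF s] by auto
  \<comment> \<open>For \<open>u = {x}\<close> the \<open>A\<close>-part is empty, so the criterion
    for the inner join does not apply; the two remaining conditions hold anyway, since
    \<open>s\<close> is a nonempty face avoiding \<open>x\<close>.\<close>
  moreover have "u - {x} \<union> s \<in> K" if "u - {x} = {}"
    unfolding that using s by simp
  moreover have "\<not> s \<subseteq> u" if "u - {x} = {}"
    using that xK[OF s] simplicial_complex_face[OF K s] by blast
  ultimately have "u \<in> link K s \<star> boundary s \<star> {{x}} \<longleftrightarrow> u \<noteq> {} \<and> \<not> s \<subseteq> u \<and> u - {x} \<union> s \<in> K"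
    by (cases "u - {x} = {}")
      (simp_all only: mem_join_singleton_iff[OF xJ] insert_iff mem_join_link_boundary_iff[OF K s]
        simp_thms)
  moreover have "u \<in> star_complement K s \<longleftrightarrow> u \<noteq> {} \<and> \<not> s \<subseteq> u \<and> x \<notin> u \<and> u \<in> K"
    using xK[of u] simplicial_complex_face[OF K, of u] by (auto simp only: star_complement_def)
  ultimately show ?thesis
    unfolding stellar_subdivision_def Un_iff by argo
qed

theorem theorem3p9:
  fixes K :: "'a set set" and s t :: "'a set" and x :: 'a
  assumes "simplicial_complex K"
    and "s \<in> K"
    and "x \<notin> vertices K"
    and "t \<in> link K s \<star> boundary s"
  shows "link (stellar_subdivision x s K) t = stellar_subdivision x (s - t) (link K t)"
proof (rule set_eqI)
  fix v
  note K = assms(1) and s = assms(2) and x = assms(3) and t = assms(4)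
  have "t \<union> s \<in> K"
    using t by (simp add: mem_join_link_boundary_iff[OF K s])
  then have xt: "x \<notin> t"
    using not_mem_face_if_not_vertex[OF K x] by blast
  \<comment> \<open>Here \<open>t \<noteq> {}\<close> and \<open>\<not> s \<subseteq> t\<close>
    discharge the nonemptiness clauses that occur on only one side.\<close>
  have nonempty: "t \<union> v \<noteq> {}" "v - {x} \<union> (s - t) \<noteq> {}"
    using t by (auto simp: mem_join_link_boundary_iff[OF K s])
  \<comment> \<open>With \<open>x \<notin> t\<close>, these rewrites express both sides in the same
    atoms, so the rest is propositional.\<close>
  have eqs: "t \<union> v - {x} \<union> s = t \<union> (v - {x} \<union> (s - t))"
      "s - t \<subseteq> v \<longleftrightarrow> s \<subseteq> t \<union> v"
      "t \<inter> (v - {x} \<union> (s - t)) = {} \<longleftrightarrow> t \<inter> v = {}"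
      "x \<notin> t \<union> v \<longleftrightarrow> x \<notin> v"
    using xt by auto
  show "v \<in> link (stellar_subdivision x s K) t \<longleftrightarrow>
      v \<in> stellar_subdivision x (s - t) (link K t)"
    unfolding mem_link_iff[OF simplicial_complex_stellar_subdivision[OF K s]]
      mem_stellar_subdivision_iff[OF K s x]
      mem_stellar_subdivision_iff[OF simplicial_complex_link[OF K] diff_mem_link[OF K s t]
        not_vertex_link[OF x]]
      mem_link_iff[OF K] eqs
    using nonempty by argo
qed

end
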